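(* Let $n \geq 4$ be an integer and let $k \geq 1$ be an integer with $k < n^{1/3}$. Let $V=\{1,\dots,n\}$. (a) Every facet of the Symmetric Traveling Salesman Polytope $T_n$ defined by one of the inequalities $0 \leq x_{ij}$ or $x_{ij} \leq 1$ (for an edge $\{i,j\}$ of $K_n$) lies on the boundary of $P_k$. (b) For every $U \subset V$ with $\emptyset \neq U \neq V$ and $|U| \leq 2k$, if the inequality $$\sum_{j \in U,\ i \in V \setminus U} x_{ij} \geq 2$$ defines a facet of $T_n$, then that facet lies on the boundary of $P_k$.
   Context: Let $K_n$ be the complete graph on $V=\{1,\dots,n\}$, and let $X$ be the set of Hamiltonian cycles in $K_n$, each identified with its incidence matrix $x=(x_{ij}) \in \mathbb{R}^{n^2}$ ($x_{ij}=1$ if the cycle contains the edge $\{i,j\}$, and $0$ otherwise). $T_n$ is the convex hull of $X$. Let $\mathbb{R}^X$ be the space of all functions $X \to \mathbb{R}$ and $L \subset \mathbb{R}^X$ the subspace of restrictions to $X$ of linear functions on $\mathbb{R}^{n^2}$. A path subset is a set $\Gamma$ of edges of $K_n$ which is a union of pairwise vertex-disjoint paths; the length of a path is its number of edges. For a nonempty path subset $\Gamma$, let $a_\Gamma$ be the number of Hamiltonian cycles containing all edges of $\Gamma$, and let $g_\Gamma \in \mathbb{R}^X$ be defined by $g_\Gamma(x) = |X|/a_\Gamma$ if $x$ contains all edges of $\Gamma$, and $g_\Gamma(x)=0$ otherwise. $P_k \subset \mathbb{R}^X$ is the convex hull of all functions $g_\Gamma$ where $\Gamma$ is a path subset of one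 of the following kinds: a single path of length $\ell$ with $1 \leq \ell \leq 2k+1$; a path of length $\ell$ with $1\le \ell \leq 2k-1$ together with a single edge vertex-disjoint from it; or $2k$ pairwise vertex-disjoint edges. A facet of $T_n$ defined by a given linear inequality is said to lie on the boundary of $P_k$ if there is a function $f \in P_k \cap L$ such that $\{x \in X : f(x) = 0\}$ is precisely the set of $x\in X$ for which the given inequality holds with equality. *)

theory Defs
  imports "HOL-Analysis.Analysis"
begin

text \<open>
  The vertex set \<open>{1, \<dots>, n}\<close> is rendered as the universe of a finite type \<open>'n\<close>,
  with \<open>n = CARD('n)\<close>. An edge of the complete graph is a two-element set of vertices,
  and paths and cycles are identified with their edge sets.
\<close>

definition path_edges :: "'n list \<Rightarrow> 'n set set" where
  "path_edges vs = {{vs ! i, vs ! Suc i} | i. Suc i < length vs}"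

definition is_path :: "nat \<Rightarrow> 'n set set \<Rightarrow> bool" where
  "is_path l p \<longleftrightarrow> (\<exists>vs. distinct vs \<and> length vs = Suc l \<and> p = path_edges vs)"

definition ham_cycles :: "'n::finite set set set" where
  "ham_cycles = {insert {last vs, hd vs} (path_edges vs) | vs.
     distinct vs \<and> set vs = UNIV \<and> 3 \<le> length vs}"

definition incidence :: "'n::finite set set \<Rightarrow> real^'n^'n" where
  "incidence C = (\<chi> i j. if {i, j} \<in> C then 1 else 0)"

definition stsp :: "(real^'n::finite^'n) set" where
  "stsp = convex hull (incidence ` ham_cycles)"

text \<open>
  A real function on the set of Hamiltonian cycles is represented as a vector indexed by all
  sets of vertex sets that is zero outside \<^const>\<open>ham_cycles\<close>, so that the library's
  convex hull applies.
\<close>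

definition lin_restr :: "(real^('n::finite set set)) set" where
  "lin_restr = {(\<chi> C. if C \<in> ham_cycles then h (incidence C) else 0) | h.
     linear (h :: real^'n^'n \<Rightarrow> real)}"

definition a_num :: "'n::finite set set \<Rightarrow> nat" where
  "a_num \<Gamma> = card {C \<in> ham_cycles. \<Gamma> \<subseteq> C}"

definition g_fun :: "'n::finite set set \<Rightarrow> real^('n set set)" where
  "g_fun \<Gamma> = (\<chi> C. if C \<in> ham_cycles \<and> \<Gamma> \<subseteq> C
     then real (card (ham_cycles :: 'n set set set)) / real (a_num \<Gamma>) else 0)"

text \<open>For \<open>l \<ge> 1\<close>, the vertex set of a path \<open>p\<close> of length \<open>l\<close> is \<open>\<Union>p\<close>.\<close>

definition gen_paths :: "nat \<Rightarrow> 'n set set set" where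
  "gen_paths k =
     {\<Gamma>. \<exists>l. 1 \<le> l \<and> l \<le> 2 * k + 1 \<and> is_path l \<Gamma>}
   \<union> {p \<union> {e} | p e. card e = 2 \<and> disjnt e (\<Union>p) \<and>
        (\<exists>l. 1 \<le> l \<and> l \<le> 2 * k - 1 \<and> is_path l p)}
   \<union> {\<Gamma>. card \<Gamma> = 2 * k \<and> (\<forall>e\<in>\<Gamma>. card e = 2) \<and> pairwise disjnt \<Gamma>}"

definition P_poly :: "nat \<Rightarrow> (real^('n::finite set set)) set" where
  "P_poly k = convex hull (g_fun ` gen_paths k)"

text \<open>The two functions \<open>l\<close> and \<open>r\<close> stand for the inequality \<open>l x \<le> r x\<close>.\<close>

definition defines_facet ::
  "(real^'n::finite^'n \<Rightarrow> real) \<Rightarrow> (real^'n^'n \<Rightarrow> real) \<Rightarrow> bool" where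
  "defines_facet l r \<longleftrightarrow>
     (\<forall>x\<in>stsp. l x \<le> r x) \<and> {x \<in> stsp. l x = r x} facet_of stsp"

definition on_boundary ::
  "nat \<Rightarrow> (real^'n::finite^'n \<Rightarrow> real) \<Rightarrow> (real^'n^'n \<Rightarrow> real) \<Rightarrow> bool" where
  "on_boundary k l r \<longleftrightarrow> (\<exists>f \<in> P_poly k \<inter> lin_restr.
     {C \<in> ham_cycles. f $ C = 0} = {C \<in> ham_cycles. l (incidence C) = r (incidence C)})"

end

theory Submission imports Defs begin

text \<open>
  The case \<open>0 \<le> x\<^sub>i\<^sub>j\<close> is immediate, since \<open>g\<close> of the one-edge path is a positive multiple of
  \<open>x\<^sub>i\<^sub>j\<close>. Everything else rests on one identity for cuts.

  Fix a proper vertex set \<open>U\<close> and a base vertex \<open>u \<in> U\<close>. A Hamiltonian cycle \<open>C\<close> visits \<open>U\<close> in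
  some number \<open>c\<close> of maximal runs, so it crosses the cut of \<open>U\<close> exactly \<open>2 c\<close> times. Exactly one
  run contains \<open>u\<close>. Each of the other \<open>c - 1\<close> runs, together with the vertices just before and
  after it, is a path contained in \<open>C\<close> whose two ends lie outside \<open>U\<close> and whose inner vertices lie
  in \<open>U - {u}\<close>; call such a path a detour. Conversely every detour contained in \<open>C\<close> arises in this
  way, because consecutive vertices of a path inside a cycle have to be consecutive on the cycle.
  As a detour can be read in two directions, the cut weight of \<open>C\<close> minus 2 is the number of vertex
  lists of detours contained in \<open>C\<close> (lemma \<open>cut_eq_detours\<close>).

  Read as an identity of functions of \<open>C\<close>, this says that the slack of the cut inequality is a sum
  of indicator functions of containment of a single path. A detour has at most \<open>card U\<close> edges,
  hence at most \<open>2 k\<close>, so after normalization the slack is a convex combination of functions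
  \<open>g\<close> of single paths and belongs to \<open>P\<^sub>k\<close>. It is also the restriction of a linear function: for
  \<open>U = {u}\<close> there are no detours, so the constant 2 agrees with the cut weight of \<open>{u}\<close> on all
  Hamiltonian cycles (lemma \<open>cut_singleton\<close>). Normalization requires that the slack is not
  identically zero, which is where the inequality being facet-defining enters
  (lemma \<open>facet_misses_cycle\<close>). Finally \<open>x\<^sub>i\<^sub>j \<le> 1\<close> is half of the cut inequality of \<open>{i, j}\<close>.
\<close>

section \<open>Paths and cut weights\<close>

text \<open>
  Applied to the positions on a cycle of the vertices of a path contained in that cycle: a path
  that never repeats a vertex cannot turn back.
\<close>

lemma unit_steps_monotone:
  fixes p :: "nat \<Rightarrow> int"
  assumes step: "\<And>i. Suc i < m \<Longrightarrow> \<bar>p (Suc i) - p i\<bar> = 1"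
    and inj: "inj_on p {..<m}"
  shows "(\<forall>i<m. p i = p 0 + int i) \<or> (\<forall>i<m. p i = p 0 - int i)"
proof (cases "1 < m")
  case True
  define d where "d = p 1 - p 0"
  have d: "d = 1 \<or> d = - 1"
    using step[of 0] True by (auto simp: d_def)
  have "p i = p 0 + int i * d" if "i < m" for i
    using that
  proof (induction i rule: induct_nat_012)
    case (ge2 i)
    have "p (Suc (Suc i)) \<noteq> p i"
      using inj ge2.prems by (auto dest!: inj_onD)
    then show ?case
      using ge2.IH ge2.prems step[of "Suc i"] d by (auto simp: algebra_simps)
  qed (auto simp: d_def)
  with d show ?thesis
    by (metis add_uminus_conv_diff mult.right_neutral mult_minus1_right)
next
  case False
  then have "i = 0" if "i < m" for i using that by linarith
  then show ?thesis by (metis add.right_neutral of_nat_0)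
qed

lemma path_edges_subset_iff:
  "path_edges ws \<subseteq> C \<longleftrightarrow> (\<forall>i. Suc i < length ws \<longrightarrow> {ws ! i, ws ! Suc i} \<in> C)"
  by (auto simp: path_edges_def)

lemma path_edges_rev: "path_edges (rev ws) = path_edges ws"
proof -
  have "path_edges (rev ws) \<subseteq> path_edges ws" for ws :: "'a list"
  proof (unfold path_edges_subset_iff, intro allI impI)
    fix i assume i: "Suc i < length (rev ws)"
    let ?j = "length ws - Suc (Suc i)"
    have "{rev ws ! i, rev ws ! Suc i} = {ws ! ?j, ws ! Suc ?j}"
      using i by (auto simp: rev_nth Suc_diff_Suc)
    then show "{rev ws ! i, rev ws ! Suc i} \<in> path_edges ws"
      using i by (auto simp: path_edges_def)
  qed
  from this[of ws] this[of "rev ws"] show ?thesis by simp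
qed

definition cut_weight :: "'n::finite set \<Rightarrow> real^'n^'n \<Rightarrow> real" where
  "cut_weight U x = (\<Sum>j\<in>U. \<Sum>i\<in>UNIV - U. x $ i $ j)"

lemma linear_cut: "linear (cut_weight U)"
  by (auto simp: linear_iff cut_weight_def sum.distrib scaleR_sum_right sum_distrib_left)

text \<open>
  Detours are kept as vertex lists, so each underlying path occurs in both directions. The factor
  2 this creates is harmless in convex combinations, and it is the factor needed to match the cut
  weight, which grows by 2 with every run.
\<close>

definition detours :: "'n set \<Rightarrow> 'n \<Rightarrow> 'n list set" where
  "detours U u = {ws. distinct ws \<and> 3 \<le> length ws \<and> hd ws \<notin> U \<and> last ws \<notin> U \<and>
     (\<forall>i. 0 < i \<and> Suc i < length ws \<longrightarrow> ws ! i \<in> U - {u})}"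

lemma rev_in_detours: "ws \<in> detours U u \<Longrightarrow> rev ws \<in> detours U u"
  unfolding detours_def by (clarsimp simp: hd_rev last_rev rev_nth)

lemma finite_detours: "finite (detours U (u :: 'n::finite))"
proof (rule finite_subset)
  show "detours U u \<subseteq> {ws. set ws \<subseteq> UNIV \<and> length ws \<le> CARD('n)}"
    by (auto simp: detours_def intro!: card_mono simp flip: distinct_card)
qed (rule finite_lists_length_le, simp)

text \<open>
  The base vertex is never on a detour, so the inner vertices number at most \<open>card U - 1\<close>; this
  keeps the path length within \<open>card U\<close>.
\<close>

lemma length_detour:
  assumes ws: "ws \<in> detours U (u :: 'n::finite)" and u: "u \<in> U"
  shows "length ws \<le> Suc (card U)"
proof -
  have "card ((!) ws ` {1..<length ws - 1}) = length ws - 2"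
    using ws by (subst card_image) (auto simp: detours_def inj_on_def nth_eq_iff_index_eq)
  moreover have "(!) ws ` {1..<length ws - 1} \<subseteq> U - {u}"
  proof (rule image_subsetI)
    fix i assume "i \<in> {1..<length ws - 1}"
    then have "0 < i \<and> Suc i < length ws" by auto
    then show "ws ! i \<in> U - {u}" using ws unfolding detours_def by blast
  qed
  then have "card ((!) ws ` {1..<length ws - 1}) \<le> card (U - {u})"
    by (intro card_mono) auto
  moreover have "card (U - {u}) = card U - 1" "card U > 0"
    using u by (auto simp: card_gt_0_iff)
  ultimately show ?thesis by linarith
qed

section \<open>Runs of a cycle through a vertex set\<close>

text \<open>
  Walking once around a cycle of length \<open>n\<close>; the return to the start is at index \<open>n\<close>. Starting at
  the base vertex makes every run that avoids it an honest interval of indices, without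
  wrap-around.
\<close>

locale cycle_enumeration =
  fixes C :: "'n::finite set set" and v :: "nat \<Rightarrow> 'n" and n :: nat
  assumes n: "3 \<le> n"
    and closed: "v n = v 0"
    and bij: "bij_betw v {..<n} UNIV"
    and C_eq: "C = (\<lambda>i. {v i, v (Suc i)}) ` {..<n}"
begin

lemma v_eq_iff: "i < n \<Longrightarrow> j < n \<Longrightarrow> v i = v j \<longleftrightarrow> i = j"
  using bij by (auto simp: bij_betw_def dest: inj_onD)

lemma edge_eq_iff:
  assumes "i < n" "j < n"
  shows "{v i, v (Suc i)} = {v j, v (Suc j)} \<longleftrightarrow> i = j"
proof
  assume e: "{v i, v (Suc i)} = {v j, v (Suc j)}"
  show "i = j"
  proof (rule ccontr)
    assume "i \<noteq> j"
    then have *: "v i = v (Suc j)" "v (Suc i) = v j"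
      using e assms v_eq_iff by (metis doubleton_eq_iff)+
    have "i = Suc j \<or> i = 0 \<and> Suc j = n"
      using * assms closed n v_eq_iff[of i "Suc j"] v_eq_iff[of i 0] by (cases "Suc j = n") auto
    moreover have "j = Suc i \<or> j = 0 \<and> Suc i = n"
      using * assms closed n v_eq_iff[of "Suc i" j] v_eq_iff[of 0 j] by (cases "Suc i = n") auto
    ultimately show False using n by auto
  qed
qed auto

definition crossings :: "'n set \<Rightarrow> nat set" where
  "crossings U = {i. i < n \<and> (v i \<in> U) \<noteq> (v (Suc i) \<in> U)}"

text \<open>
  Each crossing edge is counted once by the double sum, with its end in \<open>U\<close> as the first index.
\<close>

lemma cut_incidence: "cut_weight U (incidence C) = real (card (crossings U))"
proof -
  let ?P = "{(j, i). j \<in> U \<and> i \<notin> U \<and> {i, j} \<in> C}"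
  let ?h = "\<lambda>i. if v i \<in> U then (v i, v (Suc i)) else (v (Suc i), v i)"
  have "cut_weight U (incidence C) = (\<Sum>(j, i)\<in>U \<times> (UNIV - U). if {i, j} \<in> C then 1 else 0)"
    by (simp add: cut_weight_def incidence_def sum.cartesian_product)
  also have "\<dots> = (\<Sum>p\<in>?P. 1)"
    by (intro sum.mono_neutral_cong_right) (auto split: if_splits)
  also have "\<dots> = real (card ?P)" by simp
  finally have eq: "cut_weight U (incidence C) = real (card ?P)" .
  have "bij_betw ?h (crossings U) ?P"
  proof (rule bij_betw_imageI)
    show "inj_on ?h (crossings U)"
    proof (rule inj_onI)
      fix i j assume ij: "i \<in> crossings U" "j \<in> crossings U" and eq: "?h i = ?h j"
      have unordered: "{v q, v (Suc q)} = {fst (?h q), snd (?h q)}" for q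
        by (cases "v q \<in> U") (simp_all add: insert_commute)
      have "{v i, v (Suc i)} = {v j, v (Suc j)}"
        by (simp only: unordered eq)
      then show "i = j"
        using ij edge_eq_iff[of i j] by (simp add: crossings_def)
    qed
    show "?h ` crossings U = ?P"
    proof (intro equalityI subsetI)
      fix q assume "q \<in> ?h ` crossings U"
      then obtain i where i: "i \<in> crossings U" "q = ?h i" by blast
      then have "{v i, v (Suc i)} \<in> C" by (auto simp: crossings_def C_eq)
      then have "{v (Suc i), v i} \<in> C" by (simp add: insert_commute)
      with \<open>{v i, v (Suc i)} \<in> C\<close> i show "q \<in> ?P"
        by (cases "v i \<in> U") (simp_all add: crossings_def)
    next
      fix q assume "q \<in> ?P"
      then obtain j i k where q: "q = (j, i)" "j \<in> U" "i \<notin> U" "k < n" "{i, j} = {v k, v (Suc k)}"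
        by (auto simp: C_eq)
      then have "k \<in> crossings U" "?h k = q"
        by (auto simp: crossings_def doubleton_eq_iff)
      then show "q \<in> ?h ` crossings U" by blast
    qed
  qed
  then show ?thesis using eq by (simp add: bij_betw_same_card)
qed

text \<open>
  The positions of the vertices just before and just after a run that avoids the base vertex.
  The bound \<open>b < n\<close> excludes the final return to the base vertex.
\<close>

definition segments :: "'n set \<Rightarrow> (nat \<times> nat) set" where
  "segments U = {(a, b). Suc a < b \<and> b < n \<and> v a \<notin> U \<and> v b \<notin> U \<and>
     (\<forall>c. a < c \<and> c < b \<longrightarrow> v c \<in> U)}"

lemma finite_segments: "finite (segments U)"
  by (rule finite_subset[of _ "{..<n} \<times> {..<n}"]) (auto simp: segments_def)

text \<open>
  Around the closed walk there are as many entries into \<open>U\<close> as exits from it. The walk starts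
  inside \<open>U\<close>, so the first exit ends the run of the base vertex, and each later exit ends exactly
  one segment.
\<close>

lemma card_crossings:
  assumes U: "v 0 \<in> U" "U \<noteq> UNIV"
  shows "card (crossings U) = 2 + 2 * card (segments U)"
proof -
  define X where "X = {i. i < n \<and> v i \<in> U \<and> v (Suc i) \<notin> U}"
  define E where "E = {i. i < n \<and> v i \<notin> U \<and> v (Suc i) \<in> U}"
  have fin: "finite X" "finite E" by (auto simp: X_def E_def)
  have "int (card E) - int (card X) = (\<Sum>i<n. of_bool (v (Suc i) \<in> U) - of_bool (v i \<in> U))"
  proof -
    have "int (card E) = (\<Sum>i<n. of_bool (i \<in> E))" "int (card X) = (\<Sum>i<n. of_bool (i \<in> X))"
      by (auto simp: X_def E_def Int_def intro!: arg_cong[where f = card])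
    then have "int (card E) - int (card X) = (\<Sum>i<n. of_bool (i \<in> E) - of_bool (i \<in> X))"
      by (simp add: sum_subtractf)
    also have "\<dots> = (\<Sum>i<n. of_bool (v (Suc i) \<in> U) - of_bool (v i \<in> U))"
      by (intro sum.cong) (auto simp: X_def E_def)
    finally show ?thesis .
  qed
  also have "\<dots> = 0"
    using closed by (subst sum_lessThan_telescope) simp
  finally have EX: "card E = card X" by simp
  have "crossings U = E \<union> X" "E \<inter> X = {}"
    by (auto simp: crossings_def X_def E_def)
  then have cr: "card (crossings U) = 2 * card X"
    using EX fin by (simp add: card_Un_disjoint)
  have out: "\<exists>j<n. v j \<notin> U"
  proof -
    obtain x where "x \<notin> U" using U by auto
    moreover have "x \<in> v ` {..<n}" using bij by (simp add: bij_betw_def)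
    ultimately show ?thesis by auto
  qed
  define j where "j = (LEAST j. v j \<notin> U)"
  have j: "v j \<notin> U" "j < n" and below: "\<And>i. i < j \<Longrightarrow> v i \<in> U"
    unfolding j_def using out
    by (metis (mono_tags, lifting) LeastI, meson Least_le le_less_trans, metis not_less_Least)
  have "j > 0" using U j by (cases j) auto
  then have jX: "j - 1 \<in> X" using j below by (auto simp: X_def)
  \<comment> \<open>\<open>j - 1\<close> is the first exit; a segment is determined by the exit at its end\<close>
  have "bij_betw (\<lambda>(a, b). b - 1) (segments U) (X - {j - 1})"
  proof (rule bij_betw_imageI)
    show "inj_on (\<lambda>(a, b). b - 1) (segments U)"
    proof (rule inj_onI, clarify)
      fix a b a' b' assume *: "(a, b) \<in> segments U" "(a', b') \<in> segments U" "b - 1 = b' - 1"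
      then have "b = b'" by (auto simp: segments_def)
      with * have "\<not> a < a'" "\<not> a' < a" by (auto simp: segments_def)
      with \<open>b = b'\<close> show "a = a' \<and> b = b'" by simp
    qed
    show "(\<lambda>(a, b). b - 1) ` segments U = X - {j - 1}"
    proof (intro equalityI subsetI)
      fix i assume "i \<in> (\<lambda>(a, b). b - 1) ` segments U"
      then obtain a b where ab: "(a, b) \<in> segments U" "i = b - 1" by auto
      then have "j \<le> a" using below by (force simp: segments_def not_less[symmetric])
      with ab show "i \<in> X - {j - 1}" by (auto simp: segments_def X_def)
    next
      fix i assume i: "i \<in> X - {j - 1}"
      then have iX: "i < n" "v i \<in> U" "v (Suc i) \<notin> U" by (auto simp: X_def)
      have "Suc i \<noteq> n" using iX closed U by auto
      have "\<not> Suc i < j" using below iX by blast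
      moreover have "Suc i \<noteq> j" using i by auto
      ultimately have "j \<le> i" by linarith
      \<comment> \<open>the last position outside \<open>U\<close> before the exit, which exists since \<open>j \<le> i\<close>\<close>
      define a where "a = Max {a. a \<le> i \<and> v a \<notin> U}"
      have "a \<in> {a. a \<le> i \<and> v a \<notin> U}"
        unfolding a_def using j \<open>j \<le> i\<close> by (intro Max_in) auto
      moreover have "c \<le> a" if "c \<le> i" "v c \<notin> U" for c
        unfolding a_def using that by (intro Max_ge) auto
      moreover have "a \<noteq> i" using calculation(1) iX by auto
      ultimately have "(a, Suc i) \<in> segments U"
        using iX \<open>Suc i \<noteq> n\<close> unfolding segments_def
        by (force simp: less_Suc_eq_le not_less[symmetric])
      then show "i \<in> (\<lambda>(a, b). b - 1) ` segments U" by force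
    qed
  qed
  then have "card (segments U) = card X - 1"
    using jX fin by (simp add: bij_betw_same_card)
  moreover have "card X > 0" using jX fin by (auto simp: card_gt_0_iff)
  ultimately show ?thesis using cr by simp
qed

lemma segment_is_detour:
  assumes "(a, b) \<in> segments U" "v 0 \<in> U"
  shows "map v [a..<Suc b] \<in> detours U (v 0)" "path_edges (map v [a..<Suc b]) \<subseteq> C"
proof -
  have *: "Suc a < b" "b < n" "v a \<notin> U" "v b \<notin> U" "\<And>c. a < c \<Longrightarrow> c < b \<Longrightarrow> v c \<in> U"
    using assms by (auto simp: segments_def)
  have "inj_on v (set [a..<Suc b])"
    using * by (auto simp: inj_on_def v_eq_iff)
  moreover have "v (a + i) \<noteq> v 0" if "0 < i" "a + i < b" for i
    using that * v_eq_iff[of "a + i" 0] by auto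
  ultimately show "map v [a..<Suc b] \<in> detours U (v 0)"
    using * by (auto simp: detours_def distinct_map nth_append hd_map hd_append last_map simp del: upt_Suc)
  show "path_edges (map v [a..<Suc b]) \<subseteq> C"
    using * unfolding path_edges_subset_iff C_eq by (auto simp del: upt_Suc)
qed

text \<open>
  A detour avoids the base vertex, so its vertices have positions strictly between 0 and \<open>n\<close>, and
  each of its edges changes the position by exactly 1. Hence the positions run monotonically
  through an interval.
\<close>

lemma detour_is_segment:
  assumes ws: "ws \<in> detours U (v 0)" "path_edges ws \<subseteq> C" and U: "v 0 \<in> U"
  shows "\<exists>(a, b)\<in>segments U. ws = map v [a..<Suc b] \<or> ws = rev (map v [a..<Suc b])"
proof -
  let ?m = "length ws"
  define p where "p i = the_inv_into {..<n} v (ws ! i)" for i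
  have p: "p i < n" "v (p i) = ws ! i" for i
    using the_inv_into_into[of v "{..<n}" "ws ! i" "{..<n}"]
      f_the_inv_into_f_bij_betw[OF bij, of "ws ! i"] bij
    by (simp_all add: p_def bij_betw_def)
  have m: "3 \<le> ?m" and ends: "ws ! 0 \<notin> U" "ws ! (?m - 1) \<notin> U"
    and dist: "distinct ws"
    using ws(1) hd_conv_nth[of ws] last_conv_nth[of ws] unfolding detours_def by fastforce+
  have inner: "ws ! i \<in> U - {v 0}" if "0 < i" "Suc i < ?m" for i
    using ws(1) that unfolding detours_def by blast
  have ne0: "ws ! i \<noteq> v 0" if "i < ?m" for i
  proof (cases "i = 0 \<or> i = ?m - 1")
    case False
    with that have "0 < i" "Suc i < ?m" by linarith+
    with inner[of i] show ?thesis by auto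
  qed (use ends U in auto)
  have step: "\<bar>int (p (Suc i)) - int (p i)\<bar> = 1" if i: "Suc i < ?m" for i
  proof -
    obtain q where q: "q < n" "{ws ! i, ws ! Suc i} = {v q, v (Suc q)}"
      using ws(2) i unfolding path_edges_subset_iff C_eq by blast
    have "Suc q < n"
      using q closed ne0[of i] ne0[of "Suc i"] i by (cases "Suc q = n") (auto simp: doubleton_eq_iff)
    then have "p i = q \<and> p (Suc i) = Suc q \<or> p i = Suc q \<and> p (Suc i) = q"
      using q p[of i] p[of "Suc i"] by (metis doubleton_eq_iff v_eq_iff)
    then show ?thesis by auto
  qed
  have "inj_on (\<lambda>i. int (p i)) {..<?m}"
    using dist by (intro inj_onI) (metis p(2) lessThan_iff nth_eq_iff_index_eq of_nat_eq_iff)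
  from unit_steps_monotone[of ?m "\<lambda>i. int (p i)", OF step this]
  consider "\<forall>i<?m. p i = p 0 + i" | "\<forall>i<?m. int (p i) = int (p 0) - int i"
    by force
  then show ?thesis
  proof cases
    case 1
    let ?a = "p 0" and ?b = "p 0 + ?m - 1"
    have nth: "v (p 0 + i) = ws ! i" if "i < ?m" for i
      using 1 p(2)[of i] that by auto
    have "(?a, ?b) \<in> segments U"
    proof -
      have "v c \<in> U" if "?a < c" "c < ?b" for c
      proof -
        have "0 < c - ?a" "Suc (c - ?a) < ?m" "?a + (c - ?a) = c" using that by linarith+
        with inner[of "c - ?a"] nth[of "c - ?a"] show ?thesis by simp
      qed
      moreover have "?b < n" using 1 p(1)[of "?m - 1"] m by auto
      moreover have "v ?a \<notin> U"
        using ends(1) nth[of 0] m by (metis add_0_right not_numeral_le_zero gr0I)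
      moreover have "?b = p 0 + (?m - 1)" "?m - 1 < ?m" "Suc ?a < ?b" using m by linarith+
      then have "v ?b \<notin> U" "Suc ?a < ?b"
        using ends(2) nth[of "?m - 1"] by metis+
      ultimately show ?thesis by (simp add: segments_def)
    qed
    moreover have "ws = map v [?a..<Suc ?b]"
      using m nth by (intro nth_equalityI) (simp_all del: upt_Suc)
    ultimately show ?thesis by blast
  next
    case 2
    let ?a = "p (?m - 1)" and ?b = "p 0"
    have ab: "?b = ?a + ?m - 1" using 2[rule_format, of "?m - 1"] m by linarith
    have nth: "v (?b - i) = ws ! i" if "i < ?m" for i
    proof -
      have "int (p i) = int ?b - int i" using 2 that by blast
      then have "p i = ?b - i" by linarith
      with p(2)[of i] show ?thesis by simp
    qed
    have "(?a, ?b) \<in> segments U"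
    proof -
      have "v c \<in> U" if "?a < c" "c < ?b" for c
      proof -
        have "0 < ?b - c" "Suc (?b - c) < ?m" "?b - (?b - c) = c" using that ab by linarith+
        with inner[of "?b - c"] nth[of "?b - c"] show ?thesis by simp
      qed
      moreover have "Suc ?a < ?b" using ab m by linarith
      ultimately show ?thesis
        using ends p[of 0] p[of "?m - 1"] by (simp add: segments_def)
    qed
    moreover have "ws = rev (map v [?a..<Suc ?b])"
    proof (rule nth_equalityI)
      fix i assume "i < ?m"
      then show "ws ! i = rev (map v [?a..<Suc ?b]) ! i"
        using m nth[of i] ab by (simp add: rev_nth del: upt_Suc)
    qed (use ab m in \<open>simp del: upt_Suc\<close>)
    ultimately show ?thesis by blast
  qed
qed

text \<open>
  The forward and the backward reading of a segment differ, since its two ends are distinct.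
\<close>

lemma card_detours:
  assumes U: "v 0 \<in> U"
  shows "card {ws \<in> detours U (v 0). path_edges ws \<subseteq> C} = 2 * card (segments U)"
proof -
  define s where "s = (\<lambda>(a, b). map v [a..<Suc b])"
  have ends: "hd (s q) = v (fst q) \<and> last (s q) = v (snd q) \<and> fst q < snd q \<and> snd q < n"
    if "q \<in> segments U" for q
    using that by (auto simp: s_def segments_def hd_map last_map hd_append)
  have inj: "inj_on s (segments U)"
  proof (rule inj_onI)
    fix q r assume "q \<in> segments U" "r \<in> segments U" "s q = s r"
    then show "q = r"
      using ends[of q] ends[of r] by (auto simp: v_eq_iff prod_eq_iff)
  qed
  have inj': "inj_on (rev \<circ> s) (segments U)"
    using inj by (auto intro: comp_inj_on)
  have disj: "s ` segments U \<inter> (rev \<circ> s) ` segments U = {}"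
  proof -
    have False if "q \<in> segments U" "r \<in> segments U" "s q = rev (s r)" for q r
    proof -
      have "v (fst q) = v (snd r)" "v (snd q) = v (fst r)"
        using ends[of q] ends[of r] that by (auto simp: hd_rev last_rev)
      with ends[of q] ends[of r] that show False by (auto simp: v_eq_iff)
    qed
    then show ?thesis by auto
  qed
  have "{ws \<in> detours U (v 0). path_edges ws \<subseteq> C} = s ` segments U \<union> (rev \<circ> s) ` segments U"
  proof (intro equalityI subsetI)
    fix ws assume "ws \<in> {ws \<in> detours U (v 0). path_edges ws \<subseteq> C}"
    then obtain q where "q \<in> segments U" "ws = s q \<or> ws = rev (s q)"
      using detour_is_segment[OF _ _ U, of ws] unfolding s_def by auto
    then show "ws \<in> s ` segments U \<union> (rev \<circ> s) ` segments U" by auto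
  next
    have s: "s q \<in> detours U (v 0) \<and> path_edges (s q) \<subseteq> C" if "q \<in> segments U" for q
      using segment_is_detour[OF _ U, of "fst q" "snd q"] that by (simp add: s_def split_beta)
    fix ws assume "ws \<in> s ` segments U \<union> (rev \<circ> s) ` segments U"
    then show "ws \<in> {ws \<in> detours U (v 0). path_edges ws \<subseteq> C}"
      using s by (elim UnE imageE) (simp_all add: path_edges_rev rev_in_detours)
  qed
  then show ?thesis
    using disj card_image[OF inj] card_image[OF inj']
    by (simp add: card_Un_disjoint finite_segments del: image_comp o_apply)
qed

end

section \<open>The cut identity\<close>

lemma ham_cycle_enumeration:
  assumes "C \<in> ham_cycles"
  obtains v where "cycle_enumeration C v CARD('n::finite)" "v 0 = (u :: 'n)"
proof -
  let ?n = "CARD('n)"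
  obtain vs where vs: "distinct vs" "set vs = (UNIV :: 'n set)" "3 \<le> length vs"
    and C: "C = insert {last vs, hd vs} (path_edges vs)"
    using assms by (auto simp: ham_cycles_def)
  have len: "length vs = ?n" using vs distinct_card by metis
  obtain r where r: "r < ?n" "vs ! r = u"
    using vs len by (metis UNIV_I in_set_conv_nth)
  define v where "v i = vs ! ((i + r) mod ?n)" for i
  have shift: "bij_betw (\<lambda>i. (i + r) mod ?n) {..<?n} {..<?n}"
  proof (rule bij_betw_imageI)
    have "j \<in> (\<lambda>i. (i + r) mod ?n) ` {..<?n}" if "j < ?n" for j
    proof (rule image_eqI)
      show "j = ((j + ?n - r) mod ?n + r) mod ?n"
        using that r by (simp add: mod_add_left_eq)
    qed simp
    then show surj: "(\<lambda>i. (i + r) mod ?n) ` {..<?n} = {..<?n}" by auto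
    then show "inj_on (\<lambda>i. (i + r) mod ?n) {..<?n}"
      by (intro eq_card_imp_inj_on) simp_all
  qed
  have "bij_betw ((!) vs) {..<?n} UNIV"
    using vs len by (metis bij_betw_nth lessThan_iff)
  with shift have bij: "bij_betw v {..<?n} UNIV"
    unfolding v_def using bij_betw_trans[of "\<lambda>i. (i + r) mod ?n" "{..<?n}" "{..<?n}" "(!) vs" UNIV]
    by (simp add: comp_def)
  let ?e = "\<lambda>i. {vs ! i, vs ! (Suc i mod ?n)}"
  have "C = ?e ` {..<?n}"
  proof -
    obtain m where m: "?n = Suc m" using r by (cases "?n") auto
    have "path_edges vs = ?e ` {..<m}"
      using len m by (auto simp: path_edges_def)
    moreover have "{last vs, hd vs} = ?e m"
      using len m hd_conv_nth[of vs] last_conv_nth[of vs] by fastforce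
    ultimately show ?thesis by (simp add: C m lessThan_Suc)
  qed
  also have "\<dots> = ?e ` (\<lambda>i. (i + r) mod ?n) ` {..<?n}"
    using shift by (simp add: bij_betw_def)
  also have "\<dots> = (\<lambda>i. {v i, v (Suc i)}) ` {..<?n}"
    by (simp add: image_image v_def mod_Suc_eq)
  finally have "cycle_enumeration C v ?n"
    using bij vs len by unfold_locales (auto simp: v_def)
  moreover have "v 0 = u" using r by (simp add: v_def)
  ultimately show ?thesis by (rule that)
qed

lemma cut_eq_detours:
  assumes C: "C \<in> ham_cycles" and U: "u \<in> U" "U \<noteq> (UNIV :: 'n::finite set)"
  shows "cut_weight U (incidence C) = 2 + real (card {ws \<in> detours U u. path_edges ws \<subseteq> C})"
proof -
  obtain v where v: "cycle_enumeration C v CARD('n)" "v 0 = u"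
    using C by (rule ham_cycle_enumeration)
  interpret cycle_enumeration C v "CARD('n)" by fact
  show ?thesis
    using cut_incidence card_crossings[of U] card_detours[of U] U v(2) by simp
qed

text \<open>The degree equation: a detour would need an inner vertex in \<open>{u} - {u}\<close>.\<close>

lemma cut_singleton:
  assumes "C \<in> ham_cycles" "{u} \<noteq> (UNIV :: 'n::finite set)"
  shows "cut_weight {u} (incidence C) = 2"
proof -
  have "detours {u} u = {}"
    by (auto simp: detours_def intro!: exI[of _ 1])
  then show ?thesis using cut_eq_detours[of C u "{u}"] assms by simp
qed

lemma cut_pair:
  assumes C: "C \<in> ham_cycles" and ij: "i \<noteq> j" "{i, j} \<noteq> (UNIV :: 'n::finite set)"
  shows "cut_weight {i, j} (incidence C) = 4 - 2 * incidence C $ i $ j"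
proof -
  let ?x = "incidence C"
  have split: "(\<Sum>l\<in>UNIV - {a}. ?x $ l $ a) = (\<Sum>l\<in>UNIV - {a, b}. ?x $ l $ a) + ?x $ b $ a"
    if "a \<noteq> b" for a b
  proof -
    have "UNIV - {a} = insert b (UNIV - {a, b})" using that by auto
    then show ?thesis by simp
  qed
  have "{i} \<noteq> UNIV" "{j} \<noteq> UNIV" using ij by auto
  then have "cut_weight {i} ?x = 2" "cut_weight {j} ?x = 2" using C cut_singleton by blast+
  moreover have "?x $ j $ i = ?x $ i $ j" by (simp add: incidence_def insert_commute)
  ultimately show ?thesis
    using split[of i j] split[of j i] ij(1) by (simp add: cut_weight_def insert_commute)
qed

section \<open>Functions on the boundary\<close>

text \<open>
  The weight of a detour in the convex combination is its number of containing cycles; it cancels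
  the denominator of \<open>g\<close>, so that the combination counts detours. A detour contained in no cycle
  receives weight 0.
\<close>

lemma exists_cut_function:
  fixes U :: "'n::finite set"
  assumes U: "U \<noteq> {}" "U \<noteq> UNIV" "card U \<le> 2 * k"
    and D: "D \<in> ham_cycles" "cut_weight U (incidence D) \<noteq> 2"
  shows "\<exists>f \<in> P_poly k \<inter> lin_restr.
    {C \<in> ham_cycles. f $ C = 0} = {C \<in> ham_cycles. cut_weight U (incidence C) = 2}"
proof -
  obtain u where u: "u \<in> U" using U by blast
  let ?W = "detours U u" and ?N = "real (card (ham_cycles :: 'n set set set))"
  let ?a = "\<lambda>ws. real (a_num (path_edges ws))"
  define T where "T = (\<Sum>ws\<in>?W. ?a ws)"
  define f where "f = (\<Sum>ws\<in>?W. (?a ws / T) *\<^sub>R g_fun (path_edges ws))"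
  have a_pos: "?a ws > 0" if "C \<in> ham_cycles" "path_edges ws \<subseteq> C" for C ws
    using that by (auto simp: a_num_def card_gt_0_iff)
  have T: "T > 0"
  proof -
    have "{ws \<in> ?W. path_edges ws \<subseteq> D} \<noteq> {}"
      using cut_eq_detours[OF D(1) u U(2)] D(2) by (metis add.right_neutral card.empty of_nat_0)
    then show ?thesis
      unfolding T_def using a_pos[OF D(1)] by (auto intro!: sum_pos2 finite_detours)
  qed
  have N: "?N > 0" using D(1) by (auto simp: card_gt_0_iff)
  have f_cut: "f $ C = ?N / T * (cut_weight U (incidence C) - 2)" if C: "C \<in> ham_cycles" for C
  proof -
    have "f $ C = (\<Sum>ws\<in>?W. if path_edges ws \<subseteq> C then ?N / T else 0)"
      unfolding f_def using C a_pos[OF C] by (auto simp: g_fun_def intro!: sum.cong)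
    also have "\<dots> = ?N / T * real (card {ws \<in> ?W. path_edges ws \<subseteq> C})"
      by (simp add: sum.If_cases finite_detours Int_def)
    finally show ?thesis using cut_eq_detours[OF C u U(2)] by simp
  qed
  have "f \<in> P_poly k"
    unfolding f_def P_poly_def
  proof (rule convex_sum)
    show "(\<Sum>ws\<in>?W. ?a ws / T) = 1"
      using T by (simp add: T_def flip: sum_divide_distrib)
    fix ws assume ws: "ws \<in> ?W"
    then have "is_path (length ws - 1) (path_edges ws)"
      by (auto simp: is_path_def detours_def)
    moreover have "length ws - 1 \<le> 2 * k + 1" "1 \<le> length ws - 1"
      using length_detour[OF ws u] U(3) ws by (auto simp: detours_def)
    ultimately have "path_edges ws \<in> gen_paths k"
      unfolding gen_paths_def by blast
    then show "g_fun (path_edges ws) \<in> convex hull (g_fun ` gen_paths k)"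
      by (auto intro: hull_inc)
  qed (use T in \<open>auto simp: finite_detours convex_convex_hull\<close>)
  moreover have "f \<in> lin_restr"
  proof -
    \<comment> \<open>the constant 2 is replaced by the cut weight of \<open>{u}\<close> to make the slack linear\<close>
    define h where "h x = ?N / T * (cut_weight U x - cut_weight {u} x)" for x :: "real^'n^'n"
    have "linear (\<lambda>x. (?N / T) *\<^sub>R (cut_weight U x - cut_weight {u} x))"
      by (intro linear_compose_scale_right linear_compose_sub linear_cut)
    then have "linear h" by (simp add: h_def[abs_def])
    moreover have "{u} \<noteq> UNIV" using u U by auto
    then have "f = (\<chi> C. if C \<in> ham_cycles then h (incidence C) else 0)"
      using f_cut cut_singleton[of _ u]
      by (auto simp: vec_eq_iff h_def) (auto simp: f_def g_fun_def)
    ultimately show ?thesis by (auto simp: lin_restr_def)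
  qed
  moreover have "{C \<in> ham_cycles. f $ C = 0} = {C \<in> ham_cycles. cut_weight U (incidence C) = 2}"
    using f_cut N T by auto
  ultimately show ?thesis by blast
qed

text \<open>
  A polytope is not a facet of itself. If all its generating points satisfied the inequality with
  equality, so would the whole polytope.
\<close>

lemma facet_misses_cycle:
  assumes facet: "defines_facet l r" and conv: "convex {x. l x = r x}"
  shows "\<exists>D\<in>ham_cycles. l (incidence D) \<noteq> r (incidence D)"
proof (rule ccontr)
  assume "\<not> ?thesis"
  then have "stsp \<subseteq> {x. l x = r x}"
    unfolding stsp_def by (intro hull_minimal conv) auto
  then have "{x \<in> stsp. l x = r x} = stsp" by auto
  with facet show False by (simp add: defines_facet_def facet_of_irrefl)
qed

lemma convex_level_set:
  assumes "linear (h :: 'a::real_vector \<Rightarrow> real)"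
  shows "convex {x. h x = c}"
  using convex_linear_vimage[OF assms convex_singleton[of c]] by (simp add: vimage_def)

lemma nonneg_on_boundary:
  fixes i j :: "'n::finite"
  assumes "i \<noteq> j"
  shows "on_boundary k (\<lambda>x :: real^'n^'n. 0) (\<lambda>x. x $ i $ j)"
proof -
  let ?e = "{{i, j}}"
  define h where "h x = real (card (ham_cycles :: 'n set set set)) / real (a_num ?e) * x $ i $ j"
    for x :: "real^'n^'n"
  have "is_path 1 ?e"
    unfolding is_path_def using assms
    by (intro exI[of _ "[i, j]"]) (auto simp: path_edges_def less_Suc_eq intro!: exI[of _ 0])
  then have "?e \<in> gen_paths k" by (force simp: gen_paths_def)
  then have "g_fun ?e \<in> P_poly k" unfolding P_poly_def by (intro hull_inc imageI)
  moreover have "linear h"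
    by (simp add: h_def linear_iff ring_distribs add_divide_distrib)
  then have "g_fun ?e \<in> lin_restr"
    by (auto simp: lin_restr_def g_fun_def h_def incidence_def vec_eq_iff intro!: exI[of _ h])
  moreover have "a_num ?e > 0 \<and> ham_cycles \<noteq> ({} :: 'n set set set)"
    if "C \<in> ham_cycles" "{i, j} \<in> C" for C
    using that by (auto simp: a_num_def card_gt_0_iff)
  then have "{C \<in> ham_cycles. g_fun ?e $ C = 0} = {C \<in> ham_cycles. 0 = incidence C $ i $ j}"
    by (auto simp: g_fun_def incidence_def)
  ultimately show ?thesis unfolding on_boundary_def by blast
qed

theorem mainTheorem3:
  fixes k :: nat
  assumes "4 \<le> CARD('n::finite)"
    and "1 \<le> k"
    and "real k < real CARD('n) powr (1 / 3)"
  shows "(\<forall>i j :: 'n. i \<noteq> j \<longrightarrow>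
            (defines_facet (\<lambda>x :: real^'n^'n. 0) (\<lambda>x. x $ i $ j) \<longrightarrow>
               on_boundary k (\<lambda>x :: real^'n^'n. 0) (\<lambda>x. x $ i $ j)) \<and>
            (defines_facet (\<lambda>x :: real^'n^'n. x $ i $ j) (\<lambda>x. 1) \<longrightarrow>
               on_boundary k (\<lambda>x :: real^'n^'n. x $ i $ j) (\<lambda>x. 1)))
       \<and> (\<forall>U :: 'n set. U \<noteq> {} \<and> U \<noteq> UNIV \<and> card U \<le> 2 * k \<longrightarrow>
            defines_facet (\<lambda>x :: real^'n^'n. 2) (\<lambda>x. \<Sum>j\<in>U. \<Sum>i\<in>UNIV - U. x $ i $ j) \<longrightarrow>
            on_boundary k (\<lambda>x :: real^'n^'n. 2) (\<lambda>x. \<Sum>j\<in>U. \<Sum>i\<in>UNIV - U. x $ i $ j))"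
proof (intro conjI allI impI)
  fix i j :: 'n assume ij: "i \<noteq> j"
  show "on_boundary k (\<lambda>x :: real^'n^'n. 0) (\<lambda>x. x $ i $ j)"
    using ij by (rule nonneg_on_boundary)
  assume facet: "defines_facet (\<lambda>x :: real^'n^'n. x $ i $ j) (\<lambda>x. 1)"
  have "card {i, j} < CARD('n)" using assms(1) ij by simp
  then have U: "{i, j} \<noteq> UNIV" by (metis less_irrefl)
  have iff: "cut_weight {i, j} (incidence C) = 2 \<longleftrightarrow> incidence C $ i $ j = 1" if "C \<in> ham_cycles" for C
    using cut_pair[OF that ij U] by auto
  have "convex {x :: real^'n^'n. x $ i $ j = 1}"
    by (rule convex_level_set) (auto simp: linear_iff)
  from facet_misses_cycle[OF facet this]
  obtain D where "D \<in> ham_cycles" "cut_weight {i, j} (incidence D) \<noteq> 2"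
    using iff by auto
  with exists_cut_function[of "{i, j}" k D] U ij assms(2)
  obtain f where "f \<in> P_poly k \<inter> lin_restr"
    "{C \<in> ham_cycles. f $ C = 0} = {C \<in> ham_cycles. cut_weight {i, j} (incidence C) = 2}"
    by auto
  moreover have "{C \<in> ham_cycles. cut_weight {i, j} (incidence C) = 2} =
      {C \<in> ham_cycles. incidence C $ i $ j = 1}"
    using iff by auto
  ultimately show "on_boundary k (\<lambda>x :: real^'n^'n. x $ i $ j) (\<lambda>x. 1)"
    unfolding on_boundary_def by metis
next
  fix U :: "'n set"
  assume U: "U \<noteq> {} \<and> U \<noteq> UNIV \<and> card U \<le> 2 * k"
  assume "defines_facet (\<lambda>x :: real^'n^'n. 2) (\<lambda>x. \<Sum>j\<in>U. \<Sum>i\<in>UNIV - U. x $ i $ j)"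
  then have facet: "defines_facet (\<lambda>x. 2) (cut_weight U)" by (simp add: cut_weight_def[abs_def])
  have "convex {x. 2 = cut_weight U x}"
    using convex_level_set[OF linear_cut, of U 2] unfolding eq_commute[of 2 "cut_weight U _"] .
  from facet_misses_cycle[OF facet this]
  obtain D where "D \<in> ham_cycles" "cut_weight U (incidence D) \<noteq> 2" by metis
  with exists_cut_function[of U k D] U have "on_boundary k (\<lambda>x. 2) (cut_weight U)"
    unfolding on_boundary_def eq_commute[of 2 "cut_weight U _"] by blast
  then show "on_boundary k (\<lambda>x :: real^'n^'n. 2) (\<lambda>x. \<Sum>j\<in>U. \<Sum>i\<in>UNIV - U. x $ i $ j)"
    by (simp add: cut_weight_def[abs_def])
qed

end
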